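(* Let $\gamma_1>0$, $\gamma_2>0$, $\bm{\Sigma}_0\in\mathbb{S}^p_{++}$, $\bm{\mu}_0,\bar{\bm{\mu}}\in\mathbb{R}^p$, $\bar\gamma\ge 0$, $\theta\ge 0$, $d_0\in\mathbb{R}$, let $X\subseteq\mathbb{R}^n$ be a closed convex set, and let $$h(\bm{x},\bm{\xi})=\max_{k\in\{1,\dots,K\}}\{\bm{a}_k(\bm{x})^T\bm{\xi}+b_k(\bm{x})\},$$ where $\bm{a}_k:\mathbb{R}^n\to\mathbb{R}^p$ and $b_k:\mathbb{R}^n\to\mathbb{R}$ are linear for all $k$. Let $\phi(\bm{\xi},\bm{\xi}')=\theta\|\bm{\xi}-\bm{\xi}'\|_2$, let $Y=\{\bm{\xi}\in\mathbb{R}^p : (\bm{\xi}-\bar{\bm{\mu}})^T\bm{\Sigma}_0^{-1}(\bm{\xi}-\bar{\bm{\mu}})\le\bar\gamma\}$ and $\Xi=\mathbb{R}^p$. Then the semi-infinite problem $$\begin{aligned} \min_{\bm{x},\bm{\Lambda},\bm{q},t,r}\quad & t+\bm{\Lambda}\cdot(\gamma_2\bm{\Sigma}_0+\bm{\mu}_0\bm{\mu}_0^T)+\sqrt{\gamma_1}\,\|\bm{\Sigma}_0^{1/2}(\bm{q}+2\bm{\Lambda}\bm{\mu}_0)\|_2+\bm{q}^T\bm{\mu}_0+d_0r\\ \text{s.t.}\quad & h(\bm{x},\bm{\xi})-\bm{\xi}^T\bm{\Lambda}\bm{\xi}-\bm{q}^T\bm{\xi}-t\le r\min_{\bm{\xi}'\in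 Y}\phi(\bm{\xi},\bm{\xi}')\qquad\forall\,\bm{\xi}\in\Xi,\\ & \bm{\Lambda}\in\mathbb{S}^p_+,\ \bm{q}\in\mathbb{R}^p,\ t\in\mathbb{R},\ r\ge 0,\ \bm{x}\in X \end{aligned}$$ is equivalent to the semidefinite problem $$\begin{aligned} \min_{\bm{x},\bm{\Lambda},\bm{q},t,\bm{v}_k,z_k,r}\quad & t+\bm{\Lambda}\cdot(\gamma_2\bm{\Sigma}_0+\bm{\mu}_0\bm{\mu}_0^T)+\sqrt{\gamma_1}\,\|\bm{\Sigma}_0^{1/2}(\bm{q}+2\bm{\Lambda}\bm{\mu}_0)\|_2+\bm{q}^T\bm{\mu}_0+d_0r\\ \text{s.t.}\quad & \begin{bmatrix}\bm{\Lambda} & \frac12(\bm{v}_k+\bm{q}-\bm{a}_k(\bm{x}))\\ \frac12(\bm{v}_k+\bm{q}-\bm{a}_k(\bm{x}))^T & t-b_k(\bm{x})-\bar{\bm{\mu}}^T\bm{v}_k-z_k\end{bmatrix}\in\mathbb{S}^{p+1}_+,\\ & \sqrt{\bar\gamma}\,\|\bm{\Sigma}_0^{1/2}\bm{v}_k\|_2\le z_k,\qquad \|\bm{v}_k\|_2\le r\theta,\\ & \bm{v}_k\in\mathbb{R}^p,\ z_k\in\mathbb{R},\quad 1\le k\le K,\\ & \bm{\Lambda}\in\mathbb{S}^p_+,\ \bm{q}\in\mathbb{R}^p,\ t\in\mathbb{R},\ r\ge 0,\ \bm{x}\in X, \end{aligned}$$ in the sense that $(\bm{x},\bm{\Lambda},\bm{q},t,r)$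 is feasible for the first problem if and only if there exist $\bm{v}_k,z_k$ ($1\le k\le K$) such that $(\bm{x},\bm{\Lambda},\bm{q},t,r,(\bm{v}_k,z_k)_{k=1}^K)$ is feasible for the second; the objective functions coincide, so the two problems have the same optimal value and the same optimal $(\bm{x},\bm{\Lambda},\bm{q},t,r)$.
   Context: $\mathbb{S}^p$ is the set of real symmetric $p\times p$ matrices; $\mathbb{S}^p_+$ and $\mathbb{S}^p_{++}$ are its subsets of positive semidefinite and positive definite matrices. $\bm{A}\cdot\bm{B}=\mathrm{tr}(\bm{A}^T\bm{B})$ is the trace inner product. $\bm{\Sigma}_0^{1/2}$ is a fixed $p\times p$ matrix with $\bm{\Sigma}_0=(\bm{\Sigma}_0^{1/2})^T\bm{\Sigma}_0^{1/2}$. $n,p,K$ are positive integers. *)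

theory Defs
  imports "HOL-Analysis.Analysis"
begin

definition psd_matrices :: "(real^'m^'m) set" where
  "psd_matrices = {A. transpose A = A \<and> (\<forall>x. 0 \<le> x \<bullet> (A *v x))}"

definition pd_matrices :: "(real^'m^'m) set" where
  "pd_matrices = {A. transpose A = A \<and> (\<forall>x. x \<noteq> 0 \<longrightarrow> 0 < x \<bullet> (A *v x))}"

definition trace_inner :: "real^'m^'m \<Rightarrow> real^'m^'m \<Rightarrow> real" where
  "trace_inner A B = trace (transpose A ** B)"

definition outer_product :: "real^'m \<Rightarrow> real^'m \<Rightarrow> real^'m^'m" where
  "outer_product u v = (\<chi> i j. u $ i * v $ j)"

text \<open>The block matrix with rows \<open>(A, w)\<close> and \<open>(w\<^sup>T, s)\<close>. The index type \<^typ>\<open>'p + 1\<close> is the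
  index type \<^typ>\<open>'p\<close> with one further index, so this is a matrix of size \<open>p + 1\<close>.\<close>

definition bordered_matrix ::
    "real^'p^'p \<Rightarrow> real^'p \<Rightarrow> real \<Rightarrow> real^('p + 1)^('p + 1)" where
  "bordered_matrix A w s = (\<chi> i j.
     case i of
       Inl i' \<Rightarrow> (case j of Inl j' \<Rightarrow> A $ i' $ j' | Inr _ \<Rightarrow> w $ i')
     | Inr _ \<Rightarrow> (case j of Inl j' \<Rightarrow> w $ j' | Inr _ \<Rightarrow> s))"

definition ellipsoid :: "real^'p \<Rightarrow> real^'p^'p \<Rightarrow> real \<Rightarrow> (real^'p) set" where
  "ellipsoid \<mu> \<Sigma> \<gamma> = {\<xi>. (\<xi> - \<mu>) \<bullet> (matrix_inv \<Sigma> *v (\<xi> - \<mu>)) \<le> \<gamma>}"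

text \<open>The common objective; \<open>R\<close> stands for the fixed factor \<open>\<Sigma>\<^sub>0\<close> to the power \<open>1/2\<close>.\<close>

definition dro_objective ::
    "real \<Rightarrow> real \<Rightarrow> real^'p^'p \<Rightarrow> real^'p^'p \<Rightarrow> real^'p \<Rightarrow> real
     \<Rightarrow> real^'p^'p \<Rightarrow> real^'p \<Rightarrow> real \<Rightarrow> real \<Rightarrow> real" where
  "dro_objective \<gamma>\<^sub>1 \<gamma>\<^sub>2 \<Sigma> R \<mu> d \<Lambda> q t r =
     t + trace_inner \<Lambda> (\<gamma>\<^sub>2 *\<^sub>R \<Sigma> + outer_product \<mu> \<mu>)
       + sqrt \<gamma>\<^sub>1 * norm (R *v (q + 2 *\<^sub>R (\<Lambda> *v \<mu>))) + q \<bullet> \<mu> + d * r"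

text \<open>The minimum over \<open>Y\<close> is written as an infimum. For the ellipsoid and the scaled
  Euclidean distance it is attained, see \<open>ellipsoid_min_attained\<close> below.\<close>

definition sip_feasible ::
    "(real^'n) set \<Rightarrow> (real^'n \<Rightarrow> real^'p \<Rightarrow> real) \<Rightarrow> (real^'p) set
     \<Rightarrow> (real^'p \<Rightarrow> real^'p \<Rightarrow> real) \<Rightarrow> (real^'p) set
     \<Rightarrow> ((real^'n) \<times> (real^'p^'p) \<times> (real^'p) \<times> real \<times> real) set" where
  "sip_feasible X h \<Xi> \<phi> Y = {(x, \<Lambda>, q, t, r).
     (\<forall>\<xi>\<in>\<Xi>. h x \<xi> - \<xi> \<bullet> (\<Lambda> *v \<xi>) - q \<bullet> \<xi> - t \<le> r * (INF \<xi>'\<in>Y. \<phi> \<xi> \<xi>')) \<and>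
     \<Lambda> \<in> psd_matrices \<and> 0 \<le> r \<and> x \<in> X}"

text \<open>The variables \<open>v\<^sub>k\<close> and \<open>z\<^sub>k\<close> are families on \<^typ>\<open>nat\<close>, of which only the members with
  \<open>1 \<le> k \<le> K\<close> are constrained.\<close>

definition sdp_feasible ::
    "(real^'n) set \<Rightarrow> nat \<Rightarrow> (nat \<Rightarrow> real^'n \<Rightarrow> real^'p) \<Rightarrow> (nat \<Rightarrow> real^'n \<Rightarrow> real)
     \<Rightarrow> real^'p^'p \<Rightarrow> real^'p \<Rightarrow> real \<Rightarrow> real
     \<Rightarrow> ((real^'n) \<times> (real^'p^'p) \<times> (real^'p) \<times> real \<times> real \<times> (nat \<Rightarrow> real^'p) \<times> (nat \<Rightarrow> real)) set"
  where
  "sdp_feasible X K a b R \<mu>' \<gamma>' \<theta> = {(x, \<Lambda>, q, t, r, v, z).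
     (\<forall>k\<in>{1..K}.
        bordered_matrix \<Lambda> ((1/2) *\<^sub>R (v k + q - a k x)) (t - b k x - \<mu>' \<bullet> v k - z k)
          \<in> psd_matrices \<and>
        sqrt \<gamma>' * norm (R *v v k) \<le> z k \<and>
        norm (v k) \<le> r * \<theta>) \<and>
     \<Lambda> \<in> psd_matrices \<and> 0 \<le> r \<and> x \<in> X}"

text \<open>Extended real valued: \<open>\<infinity>\<close> for an infeasible problem, \<open>-\<infinity>\<close> for one unbounded below.\<close>

definition optimal_value :: "('a \<Rightarrow> real) \<Rightarrow> 'a set \<Rightarrow> ereal" where
  "optimal_value f F = (INF y\<in>F. ereal (f y))"

lemma ellipsoid_min_attained:
  fixes \<mu> \<xi> :: "real^'p"
  assumes "0 \<le> \<gamma>" "0 \<le> \<theta>"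
  shows "\<exists>\<xi>'\<in>ellipsoid \<mu> \<Sigma> \<gamma>.
           (INF \<eta>\<in>ellipsoid \<mu> \<Sigma> \<gamma>. \<theta> * norm (\<xi> - \<eta>)) = \<theta> * norm (\<xi> - \<xi>')"
proof -
  have "closed (ellipsoid \<mu> \<Sigma> \<gamma>)"
    unfolding ellipsoid_def by (intro closed_Collect_le continuous_intros
        linear_continuous_on_compose[OF _ matrix_vector_mul_linear])
  moreover have "\<mu> \<in> ellipsoid \<mu> \<Sigma> \<gamma>"
    using assms by (simp add: ellipsoid_def)
  ultimately obtain \<xi>' where \<xi>': "\<xi>' \<in> ellipsoid \<mu> \<Sigma> \<gamma>"
      "\<And>\<eta>. \<eta> \<in> ellipsoid \<mu> \<Sigma> \<gamma> \<Longrightarrow> dist \<xi> \<xi>' \<le> dist \<xi> \<eta>"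
    using distance_attains_inf[of "ellipsoid \<mu> \<Sigma> \<gamma>" \<xi>] by blast
  have "(INF \<eta>\<in>ellipsoid \<mu> \<Sigma> \<gamma>. \<theta> * norm (\<xi> - \<eta>)) = \<theta> * norm (\<xi> - \<xi>')"
    by (rule cInf_eq_minimum)
       (use \<xi>' assms in \<open>auto simp: dist_norm intro!: mult_left_mono\<close>)
  with \<xi>'(1) show ?thesis by blast
qed

end

theory Submission
  imports Defs
begin

text \<open>The constraint at a fixed \<open>k\<close> says that a convex quadratic \<open>f\<close> dominates the concave
  function \<open>- r \<theta> dist(\<cdot>, Y)\<close>. Separating the epigraph of \<open>f\<close> from the hypograph of the latter
  puts an affine function \<open>\<beta> - v \<bullet> \<xi>\<close> in between. That it lies above \<open>- r \<theta> dist(\<cdot>, Y)\<close> amounts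
  to \<open>\<parallel>v\<parallel> \<le> r \<theta>\<close> together with \<open>v \<bullet> \<eta> \<le> \<beta>\<close> on \<open>Y\<close>; since \<open>Y\<close> is an affine image of a ball, its
  support function is explicit and \<open>z = \<beta> - \<mu> \<bullet> v\<close>. That it lies below \<open>f\<close> is the positive
  semidefiniteness of the bordered matrix.\<close>

section \<open>Affine separation of convex from concave functions\<close>

text \<open>The strict version is taken so that it stays disjoint from an epigraph above it even
  where the two functions touch.\<close>

lemma convex_strict_hypograph:
  assumes "concave_on S g"
  shows "convex {z. fst z \<in> S \<and> snd z < g (fst z)}"
proof (rule convexI)
  fix x y and u v :: real
  assume x: "x \<in> {z. fst z \<in> S \<and> snd z < g (fst z)}"
    and y: "y \<in> {z. fst z \<in> S \<and> snd z < g (fst z)}" and uv: "0 \<le> u" "0 \<le> v" "u + v = 1"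
  have "u * snd x + v * snd y < u * g (fst x) + v * g (fst y)"
  \<comment> \<open>Strictness survives only in a term with positive weight. For
    \<open>u = 0\<close> the weight of \<open>y\<close> is 1, and otherwise the first term is
    strict.\<close>
  proof (cases "u = 0")
    case True
    then show ?thesis using uv y by simp
  next
    case False
    then have "u * snd x < u * g (fst x)" using uv x by simp
    moreover have "v * snd y \<le> v * g (fst y)" using uv y by (simp add: mult_left_mono)
    ultimately show ?thesis by simp
  qed
  also have "\<dots> \<le> g (u *\<^sub>R fst x + v *\<^sub>R fst y)"
    using assms x y uv by (simp add: concave_on_iff)
  finally show "u *\<^sub>R x + v *\<^sub>R y \<in> {z. fst z \<in> S \<and> snd z < g (fst z)}"
    using x y uv concave_on_imp_convex[OF assms] by (simp add: convexD)
qed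

text \<open>A hyperplane separates the strict hypograph of \<open>g\<close> from the epigraph of
  \<open>f\<close> in the product space. Both functions are finite on the whole space, so the
  hyperplane cannot be vertical and is the graph of an affine function.\<close>

lemma affine_between_convex_concave:
  fixes f g :: "'a::euclidean_space \<Rightarrow> real"
  assumes f: "convex_on UNIV f" and g: "concave_on UNIV g" and le: "\<And>x. g x \<le> f x"
  obtains v \<beta> where "\<And>x. g x \<le> \<beta> - v \<bullet> x" "\<And>x. \<beta> - v \<bullet> x \<le> f x"
proof -
  define S where "S = {z :: 'a \<times> real. snd z < g (fst z)}"
  have "convex S" using convex_strict_hypograph[OF g] by (simp add: S_def)
  moreover have "convex (epigraph UNIV f)" by (rule convex_epigraphI[OF f])
  moreover have "(0, g 0 - 1) \<in> S" "(0, f 0) \<in> epigraph UNIV f"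
    by (auto simp: S_def epigraph_def)
  moreover have "S \<inter> epigraph UNIV f = {}"
    using le by (auto simp: S_def epigraph_def not_le) (meson less_le_trans not_less)
  ultimately obtain c d where cd: "c \<noteq> 0" "\<forall>z\<in>S. c \<bullet> z \<le> d" "\<forall>z\<in>epigraph UNIV f. c \<bullet> z \<ge> d"
    using separating_hyperplane_sets[of S "epigraph UNIV f"] by blast
  obtain w s where c: "c = (w, s)" by (cases c)
  have lo: "w \<bullet> x + s * y \<le> d" if "y < g x" for x y
    using cd(2) that by (force simp: c S_def)
  have hi: "d \<le> w \<bullet> x + s * y" if "f x \<le> y" for x y
    using cd(3) that by (force simp: c epigraph_def)
  \<comment> \<open>Over the point 0 the epigraph has a point above one of the hypograph, so a
    negative \<open>s\<close> would reverse the separation.\<close>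
  have "s \<ge> 0"
  proof (rule ccontr)
    assume "\<not> s \<ge> 0"
    moreover have "s * (g 0 - 1) \<le> s * max (f 0) (g 0)"
      using lo[of "g 0 - 1" 0] hi[of 0 "max (f 0) (g 0)"] by simp
    ultimately have "max (f 0) (g 0) \<le> g 0 - 1" by simp
    then show False by simp
  qed
  moreover have "s \<noteq> 0"
  proof
    \<comment> \<open>A vertical hyperplane would confine all base points to
      \<open>w \<bullet> x = d\<close>, which forces \<open>w = 0\<close> and contradicts
      \<open>c \<noteq> 0\<close>.\<close>
    assume s: "s = 0"
    then have "w \<bullet> x = d" for x
      using lo[of "g x - 1" x] hi[of x "f x"] by simp
    from this[of w] this[of 0] have "w = 0" by simp
    with s c cd(1) show False by (simp add: zero_prod_def)
  qed
  ultimately have s: "s > 0" by simp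
  show thesis
  proof
    fix x
    show "g x \<le> d / s - (w /\<^sub>R s) \<bullet> x"
    \<comment> \<open>Separation speaks only of heights strictly below \<open>g x\<close>; the bound
      at \<open>g x\<close> itself is the limit.\<close>
    proof (rule dense_le)
      fix y assume "y < g x"
      from lo[OF this] s show "y \<le> d / s - (w /\<^sub>R s) \<bullet> x"
        by (simp add: field_simps)
    qed
    show "d / s - (w /\<^sub>R s) \<bullet> x \<le> f x"
      using hi[of x "f x"] s by (simp add: field_simps)
  qed
qed

section \<open>Domination of the distance to a convex set\<close>

text \<open>The convex combination of nearest points of \<open>x\<close> and \<open>y\<close> lies
  in \<open>C\<close> and competes for the distance of the combined point.\<close>

lemma convex_on_infdist:
  fixes C :: "'a::euclidean_space set"
  assumes "closed C" "convex C" "C \<noteq> {}"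
  shows "convex_on UNIV (\<lambda>x. infdist x C)"
  unfolding convex_on_def
proof (intro conjI ballI allI impI)
  fix x y :: 'a and u v :: real
  assume uv: "0 \<le> u" "0 \<le> v" "u + v = 1"
  obtain x' y' where x': "x' \<in> C" "infdist x C = dist x x'" and y': "y' \<in> C" "infdist y C = dist y y'"
    using infdist_attains_inf[OF assms(1,3)] by metis
  have "infdist (u *\<^sub>R x + v *\<^sub>R y) C \<le> dist (u *\<^sub>R x + v *\<^sub>R y) (u *\<^sub>R x' + v *\<^sub>R y')"
    using x' y' uv assms(2) by (intro infdist_le) (simp add: convexD)
  also have "\<dots> = norm (u *\<^sub>R (x - x') + v *\<^sub>R (y - y'))"
    by (simp add: dist_norm algebra_simps)
  also have "\<dots> \<le> u * infdist x C + v * infdist y C"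
    using uv norm_triangle_ineq[of "u *\<^sub>R (x - x')" "v *\<^sub>R (y - y')"] by (simp add: x' y' dist_norm)
  finally show "infdist (u *\<^sub>R x + v *\<^sub>R y) C \<le> u * infdist x C + v * infdist y C" .
qed simp

text \<open>Along the ray from \<open>y\<close> in direction \<open>v\<close> the left side grows at
  rate \<open>(norm v)\<^sup>2\<close> and the right side at rate \<open>\<rho> * norm v\<close>, so
  no constant can compensate for \<open>norm v > \<rho>\<close>.\<close>

lemma linear_le_norm_imp_norm_le:
  fixes v :: "'a::real_inner"
  assumes le: "\<And>x. v \<bullet> x \<le> \<rho> * norm (x - y) + \<beta>" and "0 \<le> \<rho>"
  shows "norm v \<le> \<rho>"
proof (rule ccontr)
  assume "\<not> norm v \<le> \<rho>"
  then have pos: "0 < norm v * (norm v - \<rho>)"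
    using assms(2) by (intro mult_pos_pos) linarith+
  have bound: "s * (norm v * (norm v - \<rho>)) \<le> \<beta> - v \<bullet> y" if "s \<ge> 0" for s
    using le[of "y + s *\<^sub>R v"] that
    by (simp add: algebra_simps power2_norm_eq_inner[symmetric] power2_eq_square)
  obtain s where "\<bar>\<beta> - v \<bullet> y\<bar> < s * (norm v * (norm v - \<rho>))"
    using reals_Archimedean3[OF pos] by blast
  \<comment> \<open>The sign of \<open>s\<close> was not recorded. For negative \<open>s\<close> the
    left side is nonpositive anyway.\<close>
  moreover have "s * (norm v * (norm v - \<rho>)) \<le> \<bar>\<beta> - v \<bullet> y\<bar>"
    using bound[of s] mult_nonpos_nonneg[of s "norm v * (norm v - \<rho>)"] pos
    by (cases "s \<ge> 0") linarith+
  ultimately show False by simp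
qed

text \<open>This trades a condition at every point for a certificate: a slope \<open>v\<close> and
  an offset \<open>\<beta>\<close>.\<close>

lemma convex_dominates_neg_infdist_iff:
  fixes f :: "'a::euclidean_space \<Rightarrow> real"
  assumes f: "convex_on UNIV f" and C: "closed C" "convex C" "C \<noteq> {}" and \<rho>: "0 \<le> \<rho>"
  shows "(\<forall>x. - f x \<le> \<rho> * infdist x C) \<longleftrightarrow>
    (\<exists>v \<beta>. norm v \<le> \<rho> \<and> (\<forall>y\<in>C. v \<bullet> y \<le> \<beta>) \<and> (\<forall>x. \<beta> - v \<bullet> x \<le> f x))" (is "?L \<longleftrightarrow> ?R")
proof
  assume ?L
  then have "- (\<rho> * infdist x C) \<le> f x" for x
    by (simp add: minus_le_iff)
  moreover have "concave_on UNIV (\<lambda>x. - (\<rho> * infdist x C))"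
    using convex_on_cmul[OF \<rho> convex_on_infdist[OF C]] by (simp add: concave_on_def)
  ultimately obtain v \<beta> where v: "\<And>x. - (\<rho> * infdist x C) \<le> \<beta> - v \<bullet> x" "\<And>x. \<beta> - v \<bullet> x \<le> f x"
    using affine_between_convex_concave[OF f] by metis
  obtain y where y: "y \<in> C" using C by blast
  have "norm v \<le> \<rho>"
  proof (rule linear_le_norm_imp_norm_le[OF _ \<rho>])
    fix x
    have "\<rho> * infdist x C \<le> \<rho> * norm (x - y)"
      using infdist_le[OF y, of x] \<rho> by (simp add: dist_norm mult_left_mono)
    then show "v \<bullet> x \<le> \<rho> * norm (x - y) + \<beta>"
      using v(1)[of x] by linarith
  qed
  moreover have "v \<bullet> y \<le> \<beta>" if "y \<in> C" for y
    using v(1)[of y] that by simp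
  ultimately show ?R using v(2) by blast
next
  assume ?R
  then obtain v \<beta> where v: "norm v \<le> \<rho>" "\<forall>y\<in>C. v \<bullet> y \<le> \<beta>" "\<forall>x. \<beta> - v \<bullet> x \<le> f x" by blast
  show ?L
  proof
    fix x
    \<comment> \<open>Write \<open>v \<bullet> x\<close> as
      \<open>v \<bullet> y + v \<bullet> (x - y)\<close> with \<open>y\<close> nearest to
      \<open>x\<close>: the first term is at most \<open>\<beta>\<close>, the second is controlled
      by Cauchy-Schwarz.\<close>
    obtain y where y: "y \<in> C" "infdist x C = dist x y"
      using infdist_attains_inf[OF C(1,3)] by metis
    have "v \<bullet> (x - y) \<le> norm v * norm (x - y)" by (rule norm_cauchy_schwarz)
    also have "\<dots> \<le> \<rho> * infdist x C"
      using v(1) by (simp add: y dist_norm mult_right_mono)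
    finally have "v \<bullet> x - v \<bullet> y \<le> \<rho> * infdist x C" by (simp add: inner_diff_right)
    moreover have "v \<bullet> y \<le> \<beta>" "\<beta> - v \<bullet> x \<le> f x" using v y by auto
    ultimately show "- f x \<le> \<rho> * infdist x C" by linarith
  qed
qed

text \<open>Connects the inner minimum in \<open>sip_feasible\<close> with \<open>infdist\<close>,
  whose convexity is known.\<close>

lemma INF_scaled_norm_eq_infdist:
  fixes C :: "'a::euclidean_space set"
  assumes "closed C" "C \<noteq> {}" "0 \<le> \<theta>"
  shows "(INF y\<in>C. \<theta> * norm (x - y)) = \<theta> * infdist x C"
proof -
  obtain y where y: "y \<in> C" "infdist x C = dist x y"
    using infdist_attains_inf[OF assms(1,2)] by metis
  show ?thesis
  proof (rule cInf_eq_minimum)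
    show "\<theta> * infdist x C \<in> (\<lambda>y. \<theta> * norm (x - y)) ` C" using y by (auto simp: dist_norm)
  next
    fix d assume "d \<in> (\<lambda>y. \<theta> * norm (x - y)) ` C"
    then show "\<theta> * infdist x C \<le> d"
      using assms(3) infdist_le by (auto simp: dist_norm[symmetric] intro!: mult_left_mono)
  qed
qed

section \<open>The ellipsoid\<close>

lemma inner_transpose_mult:
  fixes R :: "real^'n^'m"
  shows "x \<bullet> (transpose R *v y) = (R *v x) \<bullet> y"
  by (metis dot_lmul_matrix inner_commute transpose_matrix_vector)

lemma matrix_inv_right:
  assumes "invertible A"
  shows "A ** matrix_inv A = mat 1"
  using someI_ex[OF assms[unfolded invertible_def]] by (simp add: matrix_inv_def)

lemma pd_imp_invertible:
  assumes "A \<in> pd_matrices"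
  shows "invertible A"
proof -
  have "x = 0" if "A *v x = 0" for x
    using assms that by (auto simp: pd_matrices_def dest: spec[of _ x])
  then show ?thesis
    by (simp add: invertible_left_inverse matrix_left_invertible_ker)
qed

text \<open>An inverse of the product, multiplied by \<open>transpose R\<close>, is a left inverse
  of the square matrix \<open>R\<close>.\<close>

lemma invertible_factor_of_pd:
  fixes R :: "real^'p^'p"
  assumes "transpose R ** R \<in> pd_matrices"
  shows "invertible R"
  using pd_imp_invertible[OF assms]
  by (metis invertible_left_inverse matrix_mul_assoc)

text \<open>Under the substitution the quadratic form becomes \<open>u \<bullet> u\<close>. For
  negative \<open>\<gamma>\<close> the root \<open>sqrt \<gamma>\<close> is negative too, so both
  sides are empty.\<close>

lemma ellipsoid_eq_image_cball:
  fixes R :: "real^'p^'p"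
  assumes R: "invertible R"
  shows "ellipsoid \<mu> (transpose R ** R) \<gamma> = (\<lambda>u. \<mu> + transpose R *v u) ` cball 0 (sqrt \<gamma>)"
proof -
  let ?S = "transpose R ** R"
  have RT: "invertible (transpose R)" using R by (simp add: transpose_invertible)
  have S: "invertible ?S" using R RT by (rule invertible_mult[rotated])
  have mem: "\<mu> + transpose R *v u \<in> ellipsoid \<mu> ?S \<gamma> \<longleftrightarrow> u \<in> cball 0 (sqrt \<gamma>)" for u
  proof -
    let ?y = "matrix_inv ?S *v (transpose R *v u)"
    have "transpose R *v (R *v ?y) = transpose R *v u"
      using matrix_inv_right[OF S] by (metis matrix_vector_mul_assoc matrix_vector_mul_lid)
    \<comment> \<open>Cancelling \<open>transpose R\<close> shows that \<open>R\<close> times the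
      inverse of \<open>?S\<close> times \<open>transpose R\<close> is the identity.\<close>
    then have "R *v ?y = u"
      using RT by (metis inj_matrix_vector_mult injD)
    then have "(transpose R *v u) \<bullet> ?y = u \<bullet> u"
      by (metis inner_commute inner_transpose_mult)
    then have "\<mu> + transpose R *v u \<in> ellipsoid \<mu> ?S \<gamma> \<longleftrightarrow> (norm u)\<^sup>2 \<le> \<gamma>"
      by (simp add: ellipsoid_def power2_norm_eq_inner del: transpose_matrix_vector)
    also have "\<dots> \<longleftrightarrow> sqrt ((norm u)\<^sup>2) \<le> sqrt \<gamma>" by (rule real_sqrt_le_iff[symmetric])
    finally show ?thesis by simp
  qed
  have "\<xi> = \<mu> + transpose R *v (matrix_inv (transpose R) *v (\<xi> - \<mu>))" for \<xi>
    using RT by (simp add: matrix_vector_mul_assoc matrix_inv_right del: transpose_matrix_vector)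
  with mem show ?thesis by (metis (no_types, lifting) image_iff subsetI subset_antisym)
qed

text \<open>In ball coordinates this is the support function of a ball of radius
  \<open>sqrt \<gamma>\<close>, evaluated at \<open>R *v v\<close>.\<close>

lemma linear_le_on_ellipsoid_iff:
  fixes R :: "real^'p^'p"
  assumes R: "invertible R" and "0 \<le> \<gamma>"
  shows "(\<forall>\<xi>\<in>ellipsoid \<mu> (transpose R ** R) \<gamma>. v \<bullet> \<xi> \<le> \<beta>) \<longleftrightarrow> v \<bullet> \<mu> + sqrt \<gamma> * norm (R *v v) \<le> \<beta>"
    (is "?L \<longleftrightarrow> ?R")
proof -
  have eq: "?L \<longleftrightarrow> (\<forall>u\<in>cball 0 (sqrt \<gamma>). v \<bullet> \<mu> + (R *v v) \<bullet> u \<le> \<beta>)"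
    by (simp add: ellipsoid_eq_image_cball[OF R] inner_add_right inner_transpose_mult
        del: transpose_matrix_vector)
  show ?thesis
  proof
    assume L: ?L
    \<comment> \<open>The maximiser over the ball points along \<open>R *v v\<close>. As
      \<open>sgn 0 = 0\<close>, the case \<open>R *v v = 0\<close> is covered as well.\<close>
    let ?u = "sqrt \<gamma> *\<^sub>R sgn (R *v v)"
    have "?u \<in> cball 0 (sqrt \<gamma>)" using assms(2) by (simp add: norm_sgn)
    with L have "v \<bullet> \<mu> + (R *v v) \<bullet> ?u \<le> \<beta>" unfolding eq by blast
    moreover have "(R *v v) \<bullet> sgn (R *v v) = norm (R *v v)"
      by (simp add: sgn_div_norm power2_norm_eq_inner[symmetric] power2_eq_square)
        (metis left_inverse norm_eq_zero)
    ultimately show ?R by simp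
  next
    assume R: ?R
    show ?L unfolding eq
    proof
      fix u :: "real^'p" assume u: "u \<in> cball 0 (sqrt \<gamma>)"
      have "(R *v v) \<bullet> u \<le> norm (R *v v) * norm u" by (rule norm_cauchy_schwarz)
      also have "\<dots> \<le> norm (R *v v) * sqrt \<gamma>" using u by (intro mult_left_mono) auto
      finally show "v \<bullet> \<mu> + (R *v v) \<bullet> u \<le> \<beta>" using R by (simp add: mult.commute)
    qed
  qed
qed

section \<open>Positive semidefinite matrices and quadratics\<close>

lemma sum_UNIV_plus:
  fixes f :: "'a::finite + 'b::finite \<Rightarrow> 'c::comm_monoid_add"
  shows "sum f UNIV = (\<Sum>i\<in>UNIV. f (Inl i)) + (\<Sum>j\<in>UNIV. f (Inr j))"
  using sum.Plus[of UNIV UNIV f] by (simp add: comp_def)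

text \<open>The type \<open>1\<close> has a single element, so \<open>X\<close> consists of exactly
  the block \<open>x\<close> and the last coordinate \<open>s\<close>.\<close>

lemma bordered_matrix_quadratic_form:
  fixes A :: "real^'p^'p" and X :: "real^('p + 1)"
  defines "x \<equiv> \<chi> i. X $ Inl i" and "s \<equiv> X $ Inr 1"
  shows "X \<bullet> (bordered_matrix A w c *v X) = x \<bullet> (A *v x) + 2 * s * (w \<bullet> x) + c * s\<^sup>2"
  unfolding x_def s_def
  by (simp add: inner_vec_def matrix_vector_mult_def bordered_matrix_def sum_UNIV_plus
      sum.distrib sum_distrib_left sum_distrib_right algebra_simps power2_eq_square)

lemma transpose_bordered_matrix:
  "transpose (bordered_matrix A w c) = bordered_matrix (transpose A) w c"
  by (auto simp: bordered_matrix_def transpose_def vec_eq_iff split: sum.splits)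

text \<open>The form of the bordered matrix homogenises the quadratic. Where \<open>s\<close> is
  nonzero, scaling reduces to \<open>s = 1\<close>; at \<open>s = 0\<close> only the form of
  \<open>A\<close> remains.\<close>

lemma bordered_matrix_psd_iff:
  fixes A :: "real^'p^'p"
  assumes A: "A \<in> psd_matrices"
  shows "bordered_matrix A w c \<in> psd_matrices \<longleftrightarrow> (\<forall>x. 0 \<le> x \<bullet> (A *v x) + 2 * (w \<bullet> x) + c)"
proof
  assume psd: "bordered_matrix A w c \<in> psd_matrices"
  show "\<forall>x. 0 \<le> x \<bullet> (A *v x) + 2 * (w \<bullet> x) + c"
  proof
    fix x :: "real^'p"
    let ?X = "\<chi> i :: 'p + 1. case i of Inl i \<Rightarrow> x $ i | Inr _ \<Rightarrow> 1"
    have "0 \<le> ?X \<bullet> (bordered_matrix A w c *v ?X)"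
      using psd unfolding psd_matrices_def by blast
    then show "0 \<le> x \<bullet> (A *v x) + 2 * (w \<bullet> x) + c"
      unfolding bordered_matrix_quadratic_form by simp
  qed
next
  assume nonneg: "\<forall>x. 0 \<le> x \<bullet> (A *v x) + 2 * (w \<bullet> x) + c"
  have "0 \<le> x \<bullet> (A *v x) + 2 * s * (w \<bullet> x) + c * s\<^sup>2" for x s
  proof (cases "s = 0")
    case True
    then show ?thesis using A by (simp add: psd_matrices_def)
  next
    case False
    define y where "y = x /\<^sub>R s"
    have "0 \<le> s\<^sup>2 * (y \<bullet> (A *v y) + 2 * (w \<bullet> y) + c)"
      using nonneg by (intro mult_nonneg_nonneg) auto
    also have "\<dots> = (s *\<^sub>R y) \<bullet> (A *v (s *\<^sub>R y)) + 2 * s * (w \<bullet> (s *\<^sub>R y)) + c * s\<^sup>2"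
      by (simp add: matrix_vector_mult_scaleR algebra_simps power2_eq_square)
    also have "s *\<^sub>R y = x" using False by (simp add: y_def)
    finally show ?thesis .
  qed
  then show "bordered_matrix A w c \<in> psd_matrices"
    using A by (simp add: psd_matrices_def bordered_matrix_quadratic_form transpose_bordered_matrix)
qed

text \<open>Affine terms cancel in the convexity defect, which equals \<open>u * v\<close> times the
  form of \<open>A\<close> at \<open>x - y\<close>.\<close>

lemma convex_on_psd_quadratic:
  fixes A :: "real^'p^'p"
  assumes "A \<in> psd_matrices"
  shows "convex_on UNIV (\<lambda>x. x \<bullet> (A *v x) + w \<bullet> x + c)"
  unfolding convex_on_def
proof (intro conjI ballI allI impI)
  fix x y :: "real^'p" and u v :: real
  assume uv: "0 \<le> u" "0 \<le> v" "u + v = 1"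
  have v: "v = 1 - u" using uv by simp
  have "0 \<le> u * v * ((x - y) \<bullet> (A *v (x - y)))"
    using uv assms by (simp add: psd_matrices_def)
  also have "\<dots> = u * (x \<bullet> (A *v x) + w \<bullet> x + c) + v * (y \<bullet> (A *v y) + w \<bullet> y + c)
      - ((u *\<^sub>R x + v *\<^sub>R y) \<bullet> (A *v (u *\<^sub>R x + v *\<^sub>R y)) + w \<bullet> (u *\<^sub>R x + v *\<^sub>R y) + c)"
    unfolding v
    by (simp add: matrix_vector_mult_scaleR matrix_vector_mult_diff_distrib
        matrix_vector_right_distrib inner_simps algebra_simps power2_eq_square)
  finally show "(u *\<^sub>R x + v *\<^sub>R y) \<bullet> (A *v (u *\<^sub>R x + v *\<^sub>R y)) + w \<bullet> (u *\<^sub>R x + v *\<^sub>R y) + c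
      \<le> u * (x \<bullet> (A *v x) + w \<bullet> x + c) + v * (y \<bullet> (A *v y) + w \<bullet> y + c)"
    by simp
qed simp

section \<open>Equivalence of the two problems\<close>

text \<open>Meant for a projection \<open>p\<close> that forgets auxiliary variables: every preimage
  of a minimiser is a minimiser of the lifted problem.\<close>

lemma is_arg_min_image_iff:
  "is_arg_min f (\<lambda>y. y \<in> p ` F) x \<longleftrightarrow> (\<exists>w. p w = x \<and> is_arg_min (f \<circ> p) (\<lambda>w. w \<in> F) w)"
  by (auto simp: is_arg_min_def)

lemma optimal_value_image: "optimal_value f (p ` F) = optimal_value (f \<circ> p) F"
  by (simp add: optimal_value_def image_comp comp_def)

lemma ellipsoid_closed_convex_nonempty:
  fixes R :: "real^'p^'p"
  assumes "invertible R" "0 \<le> \<gamma>"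
  shows "closed (ellipsoid \<mu> (transpose R ** R) \<gamma>)" "convex (ellipsoid \<mu> (transpose R ** R) \<gamma>)"
    "ellipsoid \<mu> (transpose R ** R) \<gamma> \<noteq> {}"
proof -
  have eq: "ellipsoid \<mu> (transpose R ** R) \<gamma> = (+) \<mu> ` (*v) (transpose R) ` cball 0 (sqrt \<gamma>)"
    by (simp add: ellipsoid_eq_image_cball[OF assms(1)] image_image)
  have "compact ((*v) (transpose R) ` cball 0 (sqrt \<gamma>))"
    by (intro compact_continuous_image linear_continuous_on matrix_vector_mul_bounded_linear compact_cball)
  then show "closed (ellipsoid \<mu> (transpose R ** R) \<gamma>)"
    unfolding eq by (intro compact_imp_closed compact_translation)
  show "convex (ellipsoid \<mu> (transpose R ** R) \<gamma>)"
    unfolding eq by (intro convex_translation convex_linear_image matrix_vector_mul_linear convex_cball)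
  show "ellipsoid \<mu> (transpose R ** R) \<gamma> \<noteq> {}"
    unfolding eq using assms(2) by simp
qed

lemma semi_infinite_constraint_iff_lmi:
  fixes R \<Lambda> :: "real^'p^'p"
  assumes R: "invertible R" and "0 \<le> \<gamma>" and \<Lambda>: "\<Lambda> \<in> psd_matrices" and \<rho>: "0 \<le> \<rho>"
  shows "(\<forall>\<xi>. \<alpha> \<bullet> \<xi> + \<beta> - \<xi> \<bullet> (\<Lambda> *v \<xi>) - q \<bullet> \<xi> - t
              \<le> \<rho> * infdist \<xi> (ellipsoid \<mu> (transpose R ** R) \<gamma>)) \<longleftrightarrow>
    (\<exists>v z. bordered_matrix \<Lambda> ((1/2) *\<^sub>R (v + q - \<alpha>)) (t - \<beta> - \<mu> \<bullet> v - z) \<in> psd_matrices \<and>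
      sqrt \<gamma> * norm (R *v v) \<le> z \<and> norm v \<le> \<rho>)" (is "?L \<longleftrightarrow> ?R")
proof -
  let ?Y = "ellipsoid \<mu> (transpose R ** R) \<gamma>"
  let ?f = "\<lambda>\<xi>. \<xi> \<bullet> (\<Lambda> *v \<xi>) + (q - \<alpha>) \<bullet> \<xi> + (t - \<beta>)"
  have lmi: "bordered_matrix \<Lambda> ((1/2) *\<^sub>R (v + q - \<alpha>)) (t - \<beta> - \<mu> \<bullet> v - z) \<in> psd_matrices \<longleftrightarrow>
      (\<forall>\<xi>. \<mu> \<bullet> v + z - v \<bullet> \<xi> \<le> ?f \<xi>)" for v z
    unfolding bordered_matrix_psd_iff[OF \<Lambda>]
    by (intro all_cong1) (auto simp: inner_simps algebra_simps)
  have supp: "(\<forall>\<xi>\<in>?Y. v \<bullet> \<xi> \<le> \<mu> \<bullet> v + z) \<longleftrightarrow> sqrt \<gamma> * norm (R *v v) \<le> z" for v z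
    unfolding linear_le_on_ellipsoid_iff[OF assms(1,2)] by (simp add: inner_commute)
  have "?L \<longleftrightarrow> (\<forall>\<xi>. - ?f \<xi> \<le> \<rho> * infdist \<xi> ?Y)"
    by (intro all_cong1) (auto simp: inner_simps algebra_simps)
  also have "\<dots> \<longleftrightarrow> (\<exists>v \<beta>. norm v \<le> \<rho> \<and> (\<forall>\<xi>\<in>?Y. v \<bullet> \<xi> \<le> \<beta>) \<and> (\<forall>\<xi>. \<beta> - v \<bullet> \<xi> \<le> ?f \<xi>))"
    by (rule convex_dominates_neg_infdist_iff[OF convex_on_psd_quadratic[OF \<Lambda>]
          ellipsoid_closed_convex_nonempty[OF assms(1,2)] \<rho>])
  \<comment> \<open>Change of variable \<open>z = \<beta> - \<mu> \<bullet> v\<close>, which is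
    one-to-one for fixed \<open>v\<close>.\<close>
  also have "\<dots> \<longleftrightarrow> (\<exists>v z. norm v \<le> \<rho> \<and> (\<forall>\<xi>\<in>?Y. v \<bullet> \<xi> \<le> \<mu> \<bullet> v + z) \<and>
      (\<forall>\<xi>. \<mu> \<bullet> v + z - v \<bullet> \<xi> \<le> ?f \<xi>))"
    by (metis add.commute diff_add_cancel)
  also have "\<dots> \<longleftrightarrow> ?R"
    unfolding lmi supp by blast
  finally show ?thesis .
qed

lemma sip_feasible_iff_sdp_feasible:
  fixes R :: "real^'p^'p" and a :: "nat \<Rightarrow> real^'n \<Rightarrow> real^'p"
  assumes R: "invertible R" and \<gamma>: "0 \<le> \<gamma>" and \<theta>: "0 \<le> \<theta>" and K: "1 \<le> K"
  shows "(x, \<Lambda>, q, t, r) \<in> sip_feasible X (\<lambda>x \<xi>. MAX k\<in>{1..K}. a k x \<bullet> \<xi> + b k x) UNIV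
      (\<lambda>\<xi> \<xi>'. \<theta> * norm (\<xi> - \<xi>')) (ellipsoid \<mu> (transpose R ** R) \<gamma>) \<longleftrightarrow>
    (\<exists>v z. (x, \<Lambda>, q, t, r, v, z) \<in> sdp_feasible X K a b R \<mu> \<gamma> \<theta>)"
\<comment> \<open>These constraints are common to both problems; if they fail, both sides are
  false.\<close>
proof (cases "\<Lambda> \<in> psd_matrices \<and> 0 \<le> r \<and> x \<in> X")
  case False
  then show ?thesis by (auto simp: sip_feasible_def sdp_feasible_def)
next
  case True
  let ?Y = "ellipsoid \<mu> (transpose R ** R) \<gamma>"
  let ?P = "\<lambda>k v z. bordered_matrix \<Lambda> ((1/2) *\<^sub>R (v + q - a k x)) (t - b k x - \<mu> \<bullet> v - z)
      \<in> psd_matrices \<and> sqrt \<gamma> * norm (R *v v) \<le> z \<and> norm v \<le> r * \<theta>"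
  \<comment> \<open>Bounding the maximum means bounding each piece, as the index set is nonempty by
    \<open>1 \<le> K\<close>.\<close>
  have max: "(MAX k\<in>{1..K}. a k x \<bullet> \<xi> + b k x) - c1 - c2 - c3 \<le> d \<longleftrightarrow>
      (\<forall>k\<in>{1..K}. a k x \<bullet> \<xi> + b k x - c1 - c2 - c3 \<le> d)" for \<xi> c1 c2 c3 d
  proof -
    have "(MAX k\<in>{1..K}. a k x \<bullet> \<xi> + b k x) \<le> d + c1 + c2 + c3 \<longleftrightarrow>
        (\<forall>k\<in>{1..K}. a k x \<bullet> \<xi> + b k x \<le> d + c1 + c2 + c3)"
      using K by (subst Max_le_iff) auto
    then show ?thesis by (simp add: algebra_simps)
  qed
  have "(x, \<Lambda>, q, t, r) \<in> sip_feasible X (\<lambda>x \<xi>. MAX k\<in>{1..K}. a k x \<bullet> \<xi> + b k x) UNIV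
      (\<lambda>\<xi> \<xi>'. \<theta> * norm (\<xi> - \<xi>')) ?Y \<longleftrightarrow>
    (\<forall>k\<in>{1..K}. \<forall>\<xi>. a k x \<bullet> \<xi> + b k x - \<xi> \<bullet> (\<Lambda> *v \<xi>) - q \<bullet> \<xi> - t \<le> (r * \<theta>) * infdist \<xi> ?Y)"
    using True ellipsoid_closed_convex_nonempty[OF R \<gamma>, of \<mu>] \<theta>
    by (simp add: sip_feasible_def INF_scaled_norm_eq_infdist max mult.assoc del: One_nat_def) blast
  also have "\<dots> \<longleftrightarrow> (\<forall>k\<in>{1..K}. \<exists>v z. ?P k v z)"
    using True \<theta> by (subst semi_infinite_constraint_iff_lmi[OF R \<gamma>]) auto
  \<comment> \<open>The certificates for different \<open>k\<close> are independent, so bounded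
    choice collects them into families, arbitrary outside \<open>{1..K}\<close>.\<close>
  also have "\<dots> \<longleftrightarrow> (\<exists>v z. \<forall>k\<in>{1..K}. ?P k (v k) (z k))"
    by (simp only: bchoice_iff)
  also have "\<dots> \<longleftrightarrow> (\<exists>v z. (x, \<Lambda>, q, t, r, v, z) \<in> sdp_feasible X K a b R \<mu> \<gamma> \<theta>)"
    using True by (auto simp: sdp_feasible_def)
  finally show ?thesis .
qed

theorem theorem2p5:
  fixes \<gamma>\<^sub>1 \<gamma>\<^sub>2 \<gamma>bar \<theta> d\<^sub>0 :: real
    and K :: nat
    and \<Sigma>\<^sub>0 \<Sigma>\<^sub>0_half :: "real^'p^'p"
    and \<mu>\<^sub>0 \<mu>bar :: "real^'p"
    and X :: "(real^'n) set"
    and a :: "nat \<Rightarrow> real^'n \<Rightarrow> real^'p"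
    and b :: "nat \<Rightarrow> real^'n \<Rightarrow> real"
    and h :: "real^'n \<Rightarrow> real^'p \<Rightarrow> real"
    and \<phi> :: "real^'p \<Rightarrow> real^'p \<Rightarrow> real"
    and Y \<Xi> :: "(real^'p) set"
    and F\<^sub>1 :: "((real^'n) \<times> (real^'p^'p) \<times> (real^'p) \<times> real \<times> real) set"
    and F\<^sub>2 :: "((real^'n) \<times> (real^'p^'p) \<times> (real^'p) \<times> real \<times> real \<times> (nat \<Rightarrow> real^'p) \<times> (nat \<Rightarrow> real)) set"
    and obj\<^sub>1 :: "(real^'n) \<times> (real^'p^'p) \<times> (real^'p) \<times> real \<times> real \<Rightarrow> real"
    and obj\<^sub>2 :: "(real^'n) \<times> (real^'p^'p) \<times> (real^'p) \<times> real \<times> real \<times> (nat \<Rightarrow> real^'p) \<times> (nat \<Rightarrow> real) \<Rightarrow> real"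
  assumes "\<gamma>\<^sub>1 > 0" and "\<gamma>\<^sub>2 > 0" and "\<gamma>bar \<ge> 0" and "\<theta> \<ge> 0"
    and "\<Sigma>\<^sub>0 \<in> pd_matrices"
    and "\<Sigma>\<^sub>0 = transpose \<Sigma>\<^sub>0_half ** \<Sigma>\<^sub>0_half"
    and "closed X" and "convex X"
    and "K \<ge> 1"
    and "\<And>k. k \<in> {1..K} \<Longrightarrow> linear (a k)"
    and "\<And>k. k \<in> {1..K} \<Longrightarrow> linear (b k)"
    and "h = (\<lambda>x \<xi>. MAX k\<in>{1..K}. a k x \<bullet> \<xi> + b k x)"
    and "\<phi> = (\<lambda>\<xi> \<xi>'. \<theta> * norm (\<xi> - \<xi>'))"
    and "Y = ellipsoid \<mu>bar \<Sigma>\<^sub>0 \<gamma>bar"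
    and "\<Xi> = UNIV"
    and "F\<^sub>1 = sip_feasible X h \<Xi> \<phi> Y"
    and "F\<^sub>2 = sdp_feasible X K a b \<Sigma>\<^sub>0_half \<mu>bar \<gamma>bar \<theta>"
    and "obj\<^sub>1 = (\<lambda>(x, \<Lambda>, q, t, r). dro_objective \<gamma>\<^sub>1 \<gamma>\<^sub>2 \<Sigma>\<^sub>0 \<Sigma>\<^sub>0_half \<mu>\<^sub>0 d\<^sub>0 \<Lambda> q t r)"
    and "obj\<^sub>2 = (\<lambda>(x, \<Lambda>, q, t, r, v, z). dro_objective \<gamma>\<^sub>1 \<gamma>\<^sub>2 \<Sigma>\<^sub>0 \<Sigma>\<^sub>0_half \<mu>\<^sub>0 d\<^sub>0 \<Lambda> q t r)"
  shows "(\<forall>x \<Lambda> q t r.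
            (x, \<Lambda>, q, t, r) \<in> F\<^sub>1 \<longleftrightarrow> (\<exists>v z. (x, \<Lambda>, q, t, r, v, z) \<in> F\<^sub>2)) \<and>
         (\<forall>x \<Lambda> q t r v z. obj\<^sub>1 (x, \<Lambda>, q, t, r) = obj\<^sub>2 (x, \<Lambda>, q, t, r, v, z)) \<and>
         optimal_value obj\<^sub>1 F\<^sub>1 = optimal_value obj\<^sub>2 F\<^sub>2 \<and>
         (\<forall>x \<Lambda> q t r.
            is_arg_min obj\<^sub>1 (\<lambda>y. y \<in> F\<^sub>1) (x, \<Lambda>, q, t, r) \<longleftrightarrow>
            (\<exists>v z. is_arg_min obj\<^sub>2 (\<lambda>y. y \<in> F\<^sub>2) (x, \<Lambda>, q, t, r, v, z)))"
proof -
  define p :: "(real^'n) \<times> (real^'p^'p) \<times> (real^'p) \<times> real \<times> real \<times> (nat \<Rightarrow> real^'p) \<times> (nat \<Rightarrow> real) \<Rightarrow> _"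
    where "p = (\<lambda>(x, \<Lambda>, q, t, r, v, z). (x, \<Lambda>, q, t, r))"
  have R: "invertible \<Sigma>\<^sub>0_half"
    using invertible_factor_of_pd assms(5,6) by metis
  have feas: "(x, \<Lambda>, q, t, r) \<in> F\<^sub>1 \<longleftrightarrow> (\<exists>v z. (x, \<Lambda>, q, t, r, v, z) \<in> F\<^sub>2)" for x \<Lambda> q t r
    unfolding \<open>F\<^sub>1 = _\<close> \<open>F\<^sub>2 = _\<close> \<open>h = _\<close> \<open>\<phi> = _\<close> \<open>Y = _\<close> \<open>\<Xi> = _\<close> \<open>\<Sigma>\<^sub>0 = _\<close>
    using sip_feasible_iff_sdp_feasible[OF R \<open>\<gamma>bar \<ge> 0\<close> \<open>\<theta> \<ge> 0\<close> \<open>K \<ge> 1\<close>] .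
  \<comment> \<open>The feasibility equivalence is a statement about a projection. Since the
    objective factors through \<open>p\<close>, optimal values and minimisers transfer along the
    image.\<close>
  have F1: "F\<^sub>1 = p ` F\<^sub>2"
  proof (rule set_eqI)
    show "y \<in> F\<^sub>1 \<longleftrightarrow> y \<in> p ` F\<^sub>2" for y
      by (cases y) (simp add: feas p_def image_iff Bex_def eq_commute)
  qed
  have obj: "obj\<^sub>2 = obj\<^sub>1 \<circ> p"
    using \<open>obj\<^sub>1 = _\<close> \<open>obj\<^sub>2 = _\<close> by (auto simp: p_def fun_eq_iff)
  have "is_arg_min obj\<^sub>1 (\<lambda>y. y \<in> F\<^sub>1) (x, \<Lambda>, q, t, r) \<longleftrightarrow>
      (\<exists>v z. is_arg_min obj\<^sub>2 (\<lambda>y. y \<in> F\<^sub>2) (x, \<Lambda>, q, t, r, v, z))" for x \<Lambda> q t r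
    unfolding F1 obj is_arg_min_image_iff by (auto simp: p_def)
  moreover have "optimal_value obj\<^sub>1 F\<^sub>1 = optimal_value obj\<^sub>2 F\<^sub>2"
    unfolding F1 obj by (rule optimal_value_image)
  ultimately show ?thesis
    using feas by (simp add: obj p_def)
qed

end
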